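(* Let $f:\operatorname{dom}(f)\subseteq\mathbb{R}^n\to\mathbb{R}$ and $g:\operatorname{dom}(g)\subseteq\mathbb{R}^n\to\mathbb{R}$ be $\mathcal{C}^3$ on the open ball $B(x^0,\overline{\Delta})$, and denote by $L_f$ and $L_g$ the Lipschitz constants of $\nabla^2 f$ and $\nabla^2 g$ respectively on this ball. Let $\mathcal{X}=\langle x^0,x^1,\ldots,x^m\rangle$ be an ordered set of distinct points with radius $\Delta<\overline{\Delta}$ such that $S=S(\mathcal{X})$ has full rank. Let $\mathbb{U}=\operatorname{span}S$ and $\widehat{S}=S/\Delta$. Assume $g(x^0)\ne0$. Then $$\left\|\nabla^{cc}\left(\frac fg\right)(\mathcal{X})-\nabla\left(\frac fg\right)_{\mathbb{U}}(x^0)\right\|\le\frac{\sqrt{m}}{6}\left(L_f\left|\frac{1}{g(x^0)}\right|+L_g\left|\frac{f(x^0)}{g^2(x^0)}\right|\right)\big\|(\widehat{S}^\top)^\dagger\big\|\Delta^2.$$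
   Context: Vectors carry the Euclidean norm and matrices the induced operator norm; $A^\dagger$ is the Moore--Penrose pseudoinverse. For $\mathcal{X}=\langle x^0,x^1,\ldots,x^m\rangle\subset\mathbb{R}^n$ write $x^i=x^0+d^i$ ($m\ge1$); the radius is $\Delta=\max_i\|d^i\|$ and $S(\mathcal{X})=[d^1\ \cdots\ d^m]\in\mathbb{R}^{n\times m}$. Full rank means $\operatorname{rank}S=\min\{m,n\}$; $\operatorname{span}S$ is the column span. The generalized centred simplex gradient of $h$ over $\mathcal{X}$ is $\nabla^c h(\mathcal{X})=(S^\top)^\dagger\delta^c_h(\mathcal{X})$, where $\delta^c_h(\mathcal{X})\in\mathbb{R}^m$ has $i$-th entry $\tfrac12\big(h(x^0+d^i)-h(x^0-d^i)\big)$. The generalized centred simplex calculus gradient of $f/g$ over $\mathcal{X}$ is defined as $\nabla^{cc}\left(\frac fg\right)(\mathcal{X})=\dfrac{g(x^0)\nabla^c f(\mathcal{X})-f(x^0)\nabla^c g(\mathcal{X})}{g^2(x^0)}$. For a function $h$ defined near $x^0$, $h_{\mathbb{U}}(y)=h\big(x^0+\operatorname{Proj}_{\mathbb{U}}(y-x^0)\big)$ with $\operatorname{Proj}_{\mathbb{U}}$ the orthogonal projection onto $\mathbb{U}$. The Lipschitz constants are assumed finite: $\|\nabla^2 f(x)-\nabla^2 f(y)\|\le L_f\|x-y\|$ on $B(x^0,\overline{\Delta})$, and similarly for $g$. *)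

theory Defs
  imports "HOL-Analysis.Analysis"
begin

section \<open>Moore--Penrose pseudoinverse and orthogonal projection\<close>

text \<open>The four Penrose conditions; every real matrix has exactly one such \<open>B\<close>.\<close>

definition is_pinv :: "real^'n^'m \<Rightarrow> real^'m^'n \<Rightarrow> bool" where
  "is_pinv A B \<longleftrightarrow>
     A ** B ** A = A \<and> B ** A ** B = B \<and>
     transpose (A ** B) = A ** B \<and> transpose (B ** A) = B ** A"

definition pinv :: "real^'n^'m \<Rightarrow> real^'m^'n" where
  "pinv A = (THE B. is_pinv A B)"

text \<open>The norm instance of \<^typ>\<open>real^'n^'m\<close> is the Frobenius norm, not the
  operator norm induced by the Euclidean norms, which is meant here.\<close>

definition opnorm :: "real^'n^'m \<Rightarrow> real" where
  "opnorm A = onorm ((*v) A)"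

definition orth_proj :: "(real^'n) set \<Rightarrow> real^'n \<Rightarrow> real^'n" where
  "orth_proj U y = (THE p. p \<in> U \<and> y - p \<in> orthogonal_comp U)"


section \<open>Smoothness, gradient and Hessian\<close>

text \<open>In finite dimension, being \<open>C\<^sup>k\<close> is equivalent to all directional derivatives
  existing up to order \<open>k\<close>, with total differentiability below order \<open>k\<close> and
  continuity at order \<open>k\<close>; the recursion differentiates along fixed directions \<open>v\<close>.\<close>

primrec Ck_on :: "nat \<Rightarrow> (real^'n \<Rightarrow> real) \<Rightarrow> (real^'n) set \<Rightarrow> bool" where
  "Ck_on 0 h A \<longleftrightarrow> continuous_on A h"
| "Ck_on (Suc k) h A \<longleftrightarrow>
     (\<forall>y\<in>A. h differentiable (at y)) \<and>
     (\<forall>v. Ck_on k (\<lambda>y. frechet_derivative h (at y) v) A)"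

definition gradient :: "(real^'n \<Rightarrow> real) \<Rightarrow> real^'n \<Rightarrow> real^'n" where
  "gradient h y = (THE D. GDERIV h y :> D)"

definition hessian :: "(real^'n \<Rightarrow> real) \<Rightarrow> real^'n \<Rightarrow> real^'n^'n" where
  "hessian h y = jacobian (gradient h) (at y)"


section \<open>Sample sets and simplex gradients\<close>

text \<open>A sample set \<open>\<langle>x\<^sup>0, x\<^sup>1, \<dots>, x\<^sup>m\<rangle>\<close> is given by its base point \<open>x0\<close> and the
  family \<open>x\<close> of the other points, indexed by a finite type with \<open>m\<close> elements.\<close>

definition distinct_points :: "real^'n \<Rightarrow> ('m::finite \<Rightarrow> real^'n) \<Rightarrow> bool" where
  "distinct_points x0 x \<longleftrightarrow> inj x \<and> x0 \<notin> range x"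

definition radius :: "real^'n \<Rightarrow> ('m::finite \<Rightarrow> real^'n) \<Rightarrow> real" where
  "radius x0 x = Max (range (\<lambda>i. norm (x i - x0)))"

text \<open>Column \<open>j\<close> is \<open>d\<^sup>j = x\<^sup>j - x\<^sup>0\<close>.\<close>

definition simplex_matrix :: "real^'n \<Rightarrow> ('m::finite \<Rightarrow> real^'n) \<Rightarrow> real^'m^'n" where
  "simplex_matrix x0 x = (\<chi> i j. (x j - x0) $ i)"

definition centred_diff ::
  "(real^'n \<Rightarrow> real) \<Rightarrow> real^'n \<Rightarrow> ('m::finite \<Rightarrow> real^'n) \<Rightarrow> real^'m" where
  "centred_diff h x0 x = (\<chi> i. (h (x0 + (x i - x0)) - h (x0 - (x i - x0))) / 2)"

definition centred_simplex_gradient ::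
  "(real^'n \<Rightarrow> real) \<Rightarrow> real^'n \<Rightarrow> ('m::finite \<Rightarrow> real^'n) \<Rightarrow> real^'n" where
  "centred_simplex_gradient h x0 x =
     pinv (transpose (simplex_matrix x0 x)) *v centred_diff h x0 x"

definition centred_quotient_gradient ::
  "(real^'n \<Rightarrow> real) \<Rightarrow> (real^'n \<Rightarrow> real) \<Rightarrow> real^'n \<Rightarrow> ('m::finite \<Rightarrow> real^'n) \<Rightarrow> real^'n" where
  "centred_quotient_gradient f g x0 x =
     (g x0 *\<^sub>R centred_simplex_gradient f x0 x - f x0 *\<^sub>R centred_simplex_gradient g x0 x)
       /\<^sub>R (g x0)\<^sup>2"

definition proj_fun ::
  "(real^'n) set \<Rightarrow> real^'n \<Rightarrow> (real^'n \<Rightarrow> real) \<Rightarrow> real^'n \<Rightarrow> real" where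
  "proj_fun U x0 h y = h (x0 + orth_proj U (y - x0))"

end

theory Submission
  imports Defs
begin

text \<open>
  Write \<open>A = S\<^sup>T\<close>, \<open>d\<^sup>i = x\<^sup>i - x\<^sup>0\<close>, and let \<open>P\<close> be the orthogonal projection onto
  \<open>\<U> = span S\<close>.  Two facts drive the estimate.

  The first is linear algebra: the Penrose conditions make \<open>A\<^sup>\<dagger> A\<close> a symmetric idempotent whose
  range is the row space of \<open>A\<close>, that is, \<open>A\<^sup>\<dagger> A = P\<close>.  The chain rule gives
  \<open>\<nabla>h\<^sub>\<U>(x\<^sup>0) = P \<nabla>h(x\<^sup>0)\<close>, so for a single function the error of the centred simplex gradient
  is \<open>A\<^sup>\<dagger> (\<delta> - A \<nabla>h(x\<^sup>0))\<close>: the pseudoinverse is applied to the vector of errors of the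
  central differences along the directions \<open>d\<^sup>i\<close>.

  The second is Taylor's formula: \<open>t \<mapsto> h(x\<^sup>0 + t d) - h(x\<^sup>0 - t d) - 2 t d \<bullet> \<nabla>h(x\<^sup>0)\<close> vanishes
  together with its first derivative at \<open>0\<close>, and its second derivative \<open>d \<bullet> (\<nabla>\<^sup>2h(x\<^sup>0 + t d) - \<nabla>\<^sup>2h(x\<^sup>0 - t d)) d\<close> is at
  most \<open>2 L t \<parallel>d\<parallel>\<^sup>3\<close> in absolute value, because the contributions of the Hessian at \<open>x\<^sup>0\<close>
  have cancelled.  Integrating twice
  bounds each entry of the error vector by \<open>L \<parallel>d\<^sup>i\<parallel>\<^sup>3 / 6\<close>, hence its norm by
  \<open>\<surd>m L \<Delta>\<^sup>3 / 6\<close>.  Passing from \<open>S\<close> to \<open>S/\<Delta>\<close> multiplies the pseudoinverse by \<open>\<Delta>\<close>, which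
  turns \<open>\<Delta>\<^sup>3\<close> into \<open>\<Delta>\<^sup>2\<close>.

  Finally, both the calculus gradient and \<open>P \<nabla>(f/g)(x\<^sup>0)\<close> are the same linear combination,
  given by the quotient rule, of the corresponding gradients of \<open>f\<close> and \<open>g\<close>, so the triangle
  inequality combines the two single-function estimates.
\<close>

section \<open>Orthogonal projection and the pseudoinverse\<close>

lemma orth_proj_eqI:
  assumes U: "subspace U" and p: "p \<in> U" "y - p \<in> orthogonal_comp U"
  shows "orth_proj U y = p"
  unfolding orth_proj_def
proof (rule the_equality)
  fix q assume q: "q \<in> U \<and> y - q \<in> orthogonal_comp U"
  have "p - q \<in> U" using U p q by (simp add: subspace_diff)
  moreover have "(y - q) - (y - p) \<in> orthogonal_comp U"
    using subspace_diff[OF subspace_orthogonal_comp] p q by blast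
  ultimately have "p - q \<in> U \<inter> orthogonal_comp U" by simp
  then show "q = p" using orthogonal_Int_0[OF U] by auto
qed (use p in auto)

lemma orth_proj_decomposition:
  assumes "subspace U"
  shows "orth_proj U y \<in> U" "y - orth_proj U y \<in> orthogonal_comp U"
proof -
  obtain p z where p: "p \<in> span U" and z: "\<And>w. w \<in> span U \<Longrightarrow> orthogonal z w" and y: "y = p + z"
    using orthogonal_subspace_decomp_exists[of U y] by metis
  have "p \<in> U" using p assms by (metis span_eq_iff)
  moreover have "y - p \<in> orthogonal_comp U"
    using z y by (auto simp: orthogonal_comp_def orthogonal_commute span_base)
  ultimately show "orth_proj U y \<in> U" "y - orth_proj U y \<in> orthogonal_comp U"
    using orth_proj_eqI[OF assms] by auto
qed

lemma linear_orth_proj: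
  fixes U :: "(real^'n) set"
  assumes U: "subspace U"
  shows "linear (orth_proj U)"
proof (rule linearI)
  fix y z :: "real^'n" and c :: real
  note dec = orth_proj_decomposition[OF U]
  have "(y - orth_proj U y) + (z - orth_proj U z) \<in> orthogonal_comp U"
    by (intro subspace_add subspace_orthogonal_comp dec)
  then show "orth_proj U (y + z) = orth_proj U y + orth_proj U z"
    by (intro orth_proj_eqI subspace_add U dec) (simp add: algebra_simps)
  have "c *\<^sub>R (y - orth_proj U y) \<in> orthogonal_comp U"
    by (intro subspace_scale subspace_orthogonal_comp dec)
  then show "orth_proj U (c *\<^sub>R y) = c *\<^sub>R orth_proj U y"
    by (intro orth_proj_eqI subspace_scale U dec) (simp add: algebra_simps)
qed

lemma orth_proj_self_adjoint:
  assumes U: "subspace U"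
  shows "orth_proj U y \<bullet> z = y \<bullet> orth_proj U z"
proof -
  note dec = orth_proj_decomposition[OF U]
  have "orth_proj U y \<bullet> (z - orth_proj U z) = 0" "orth_proj U z \<bullet> (y - orth_proj U y) = 0"
    using dec(1)[of y] dec(2)[of z] dec(1)[of z] dec(2)[of y]
    by (auto simp: orthogonal_comp_def orthogonal_def)
  then show ?thesis
    by (simp add: inner_diff_right inner_commute)
qed

lemma inner_matrix_transpose:
  fixes A :: "real^'n^'m"
  shows "(A *v x) \<bullet> y = x \<bullet> (transpose A *v y)"
  by (metis dot_lmul_matrix transpose_matrix_vector inner_commute)

lemma symmetric_matrixI:
  fixes M :: "real^'n^'n"
  assumes "\<And>x y. (M *v x) \<bullet> y = x \<bullet> (M *v y)"
  shows "transpose M = M"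
proof -
  have "x \<bullet> (transpose M *v y - M *v y) = 0" for x y
    using assms[of x y] inner_matrix_transpose[of M x y] by (simp add: inner_diff_right)
  then have "transpose M *v y = M *v y" for y
    using inner_eq_zero_iff[of "transpose M *v y - M *v y"] by (metis eq_iff_diff_eq_0)
  then show ?thesis by (simp only: matrix_eq) blast
qed

text \<open>Two pseudoinverses have \<open>A B = A C\<close>: as \<open>A B = (A C) (A B)\<close> is symmetric, it also equals
  \<open>(A B) (A C) = A C\<close>.  Likewise \<open>B A = C A\<close>, and then \<open>B = B A B = C A C = C\<close>.\<close>

lemma is_pinv_unique:
  assumes B: "is_pinv A B" and C: "is_pinv A C"
  shows "B = C"
proof -
  note pen = B[unfolded is_pinv_def] C[unfolded is_pinv_def]
  have "A ** B = transpose ((A ** C) ** (A ** B))"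
    using pen by (metis matrix_mul_assoc)
  also have "\<dots> = (A ** B) ** (A ** C)"
    using pen by (simp add: matrix_transpose_mul)
  also have "\<dots> = A ** C" using pen by (metis matrix_mul_assoc)
  finally have l: "A ** B = A ** C" .
  have "B ** A = transpose ((B ** A) ** (C ** A))"
    using pen by (metis matrix_mul_assoc)
  also have "\<dots> = (C ** A) ** (B ** A)"
    using pen by (simp add: matrix_transpose_mul)
  also have "\<dots> = C ** A" using pen by (metis matrix_mul_assoc)
  finally have r: "B ** A = C ** A" .
  show ?thesis using pen l r by (metis matrix_mul_assoc)
qed

text \<open>The map \<open>A\<close> is injective on its row space \<open>R\<close>, because its kernel is the orthogonal
  complement of \<open>R\<close>.  A linear left inverse \<open>k\<close> of \<open>A\<close> on \<open>R\<close>, preceded by the projection \<open>Q\<close>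
  onto the range of \<open>A\<close>, is a pseudoinverse \<open>B\<close>: then \<open>A B = Q\<close>, and \<open>B A\<close> is the projection
  onto \<open>R\<close>.\<close>

lemma is_pinv_exists:
  fixes A :: "real^'n^'m"
  shows "\<exists>B. is_pinv A B"
proof -
  define R where "R = range ((*v) (transpose A))"
  define C where "C = range ((*v) A)"
  define P where "P = orth_proj R"
  define Q where "Q = orth_proj C"
  have R: "subspace R" and C: "subspace C"
    unfolding R_def C_def by (intro linear_subspace_image subspace_UNIV matrix_vector_mul_linear)+
  have ker: "A *v z = 0" if "z \<in> orthogonal_comp R" for z
  proof -
    have "(transpose A *v (A *v z)) \<bullet> z = 0"
      using that by (auto simp: R_def orthogonal_comp_def orthogonal_def)
    then have "(A *v z) \<bullet> (A *v z) = 0"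
      by (metis inner_matrix_transpose inner_commute)
    then show ?thesis by simp
  qed
  have AP: "A *v P x = A *v x" for x
    using ker[OF orth_proj_decomposition(2)[OF R], of x]
    by (simp add: P_def matrix_vector_mult_diff_distrib)
  have PR: "P x \<in> R" for x unfolding P_def by (rule orth_proj_decomposition(1)[OF R])
  have inj: "inj_on ((*v) A) R"
  proof (rule inj_onI)
    fix y z assume y: "y \<in> R" and z: "z \<in> R" and eq: "A *v y = A *v z"
    have yz: "y - z \<in> R" using R y z by (simp add: subspace_diff)
    have "(transpose A *v w) \<bullet> (y - z) = 0" for w
      using eq by (metis inner_matrix_transpose inner_commute matrix_vector_mult_diff_distrib
          diff_self inner_zero_right)
    then have "y - z \<in> orthogonal_comp R"
      by (auto simp: R_def orthogonal_comp_def orthogonal_def)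
    with yz have "y - z \<in> R \<inter> orthogonal_comp R" by simp
    then show "y = z" using orthogonal_Int_0[OF R] by simp
  qed
  obtain k where k: "linear k" and kA: "\<And>v. v \<in> R \<Longrightarrow> k (A *v v) = v"
    using linear_exists_left_inverse_on[OF matrix_vector_mul_linear R inj] by blast
  have "linear (\<lambda>y. k (Q y))"
    using linear_compose[OF linear_orth_proj[OF C] k] by (simp add: Q_def o_def)
  then have kQ: "matrix (\<lambda>y. k (Q y)) *v y = k (Q y)" for y
    by (rule matrix_works[OF linear_matrix_vector_mul_eq[THEN iffD2]])
  define B where "B = matrix (\<lambda>y. k (Q y))"
  have Bv: "B *v y = k (Q y)" for y unfolding B_def by (rule kQ)
  have QA: "Q (A *v x) = A *v x" for x
    unfolding Q_def
    by (intro orth_proj_eqI C)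
      (auto simp: C_def orthogonal_comp_def orthogonal_def)
  have BA: "B *v (A *v x) = P x" for x
    using kA[OF PR, of x] by (simp add: Bv QA AP)
  have AB: "A *v (B *v y) = Q y" for y
  proof -
    have "Q y \<in> C" unfolding Q_def by (rule orth_proj_decomposition(1)[OF C])
    then obtain x where "Q y = A *v x" by (auto simp: C_def)
    then show ?thesis using kA[OF PR, of x] by (simp add: Bv AP)
  qed
  have QQ: "Q (Q y) = Q y" for y using AB QA by metis
  have "A ** B ** A = A" "B ** A ** B = B"
    by (simp_all add: matrix_eq matrix_vector_mul_assoc[symmetric] AB QA)
      (simp add: Bv QQ)
  moreover have "transpose (A ** B) = A ** B"
    by (rule symmetric_matrixI)
      (simp add: matrix_vector_mul_assoc[symmetric] AB, simp add: Q_def orth_proj_self_adjoint[OF C])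
  moreover have "transpose (B ** A) = B ** A"
    by (rule symmetric_matrixI)
      (simp add: matrix_vector_mul_assoc[symmetric] BA, simp add: P_def orth_proj_self_adjoint[OF R])
  ultimately show ?thesis by (auto simp: is_pinv_def)
qed

lemma pinv_eqI: "is_pinv A B \<Longrightarrow> pinv A = B"
  unfolding pinv_def by (blast intro: is_pinv_unique)

lemma is_pinv_pinv: "is_pinv A (pinv A)"
  using is_pinv_exists pinv_eqI by metis

lemma pinv_scaleR:
  assumes "c \<noteq> 0"
  shows "pinv (c *\<^sub>R A) = inverse c *\<^sub>R pinv A"
  using is_pinv_pinv[of A] assms
  by (intro pinv_eqI)
    (simp add: is_pinv_def matrix_scalar_ac flip: scalar_matrix_assoc)

text \<open>With \<open>A = S\<^sup>T\<close>, the Penrose conditions say that \<open>A\<^sup>\<dagger> A\<close> is symmetric and that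
  \<open>A (y - A\<^sup>\<dagger> A y) = 0\<close>.  Symmetry gives \<open>A\<^sup>\<dagger> A = S (A\<^sup>\<dagger>)\<^sup>T\<close>, whose values lie in the column
  span of \<open>S\<close>; the second identity says that the residual is orthogonal to that span.\<close>

lemma pinv_transpose_mult_eq_orth_proj:
  fixes S :: "real^'m^'n"
  shows "pinv (transpose S) *v (transpose S *v y) = orth_proj (span (columns S)) y"
proof (rule orth_proj_eqI[symmetric, OF subspace_span])
  let ?A = "transpose S" and ?B = "pinv (transpose S)"
  have pen: "?A ** ?B ** ?A = ?A" "transpose (?B ** ?A) = ?B ** ?A"
    using is_pinv_pinv[of ?A] by (auto simp: is_pinv_def)
  have "?B ** ?A = S ** transpose ?B"
    using pen(2) by (metis matrix_transpose_mul transpose_transpose)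
  then have "?B *v (?A *v y) = S *v (transpose ?B *v y)"
    by (metis matrix_vector_mul_assoc)
  then show "?B *v (?A *v y) \<in> span (columns S)"
    by (metis matrix_vector_mult_in_columnspace)
  have "?A *v (y - ?B *v (?A *v y)) = 0"
    using pen(1)
    by (metis matrix_vector_mult_diff_distrib matrix_vector_mul_assoc diff_self)
  moreover have "columns S \<subseteq> range ((*v) S)"
    by (auto simp: columns_def image_iff) (metis matrix_vector_mul_component matrix_vector_mult_basis)
  then have "span (columns S) \<subseteq> range ((*v) S)"
    by (intro span_minimal linear_subspace_image matrix_vector_mul_linear subspace_UNIV)
  ultimately show "y - ?B *v (?A *v y) \<in> orthogonal_comp (span (columns S))"
    by (force simp: orthogonal_comp_def orthogonal_def inner_matrix_transpose
        simp del: transpose_matrix_vector)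
qed


section \<open>Gradient and Hessian\<close>

lemma gradient_eqI:
  assumes "GDERIV h y :> D"
  shows "gradient h y = D"
  unfolding gradient_def
proof (rule the_equality)
  fix E assume "GDERIV h y :> E"
  then have "(\<lambda>v. v \<bullet> E) = (\<lambda>v. v \<bullet> D)"
    using assms unfolding gderiv_def by (metis has_derivative_unique)
  then have "(E - D) \<bullet> (E - D) = 0"
    by (metis inner_diff_right right_minus_eq)
  then show "E = D" by simp
qed (fact assms)

lemma GDERIV_basis_sum:
  fixes h :: "real^'n \<Rightarrow> real"
  assumes "h differentiable (at y)"
  shows "GDERIV h y :> (\<Sum>b\<in>Basis. frechet_derivative h (at y) b *\<^sub>R b)"
proof -
  let ?F = "frechet_derivative h (at y)"
  have F: "(h has_derivative ?F) (at y)"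
    using assms by (simp add: frechet_derivative_works)
  interpret F: bounded_linear ?F using F by (rule has_derivative_bounded_linear)
  have "?F v = v \<bullet> (\<Sum>b\<in>Basis. ?F b *\<^sub>R b)" for v
  proof -
    have "?F v = ?F (\<Sum>b\<in>Basis. (v \<bullet> b) *\<^sub>R b)" by (simp add: euclidean_representation)
    also have "\<dots> = (\<Sum>b\<in>Basis. (v \<bullet> b) *\<^sub>R ?F b)" by (simp add: F.sum F.scaleR)
    finally show ?thesis by (simp add: inner_sum_right mult.commute)
  qed
  then have "?F = (\<lambda>v. v \<bullet> (\<Sum>b\<in>Basis. ?F b *\<^sub>R b))" by (rule ext)
  with F show ?thesis unfolding gderiv_def by simp
qed

lemma Ck_on_GDERIV:
  assumes "Ck_on (Suc k) h A" "y \<in> A"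
  shows "GDERIV h y :> gradient h y"
  using GDERIV_basis_sum[of h y] gradient_eqI[of h y] assms by auto

text \<open>The gradient is differentiable because its coordinates are the partial derivatives of \<open>h\<close>,
  each of which is differentiable; the Hessian is its Jacobian by definition.\<close>

lemma Ck_on_gradient_has_derivative:
  fixes h :: "real^'n \<Rightarrow> real"
  assumes C: "Ck_on (Suc (Suc k)) h A" and A: "open A" and y: "y \<in> A"
  shows "(gradient h has_derivative ((*v) (hessian h y))) (at y)"
proof -
  let ?G = "\<lambda>z. \<Sum>b\<in>Basis. frechet_derivative h (at z) b *\<^sub>R b"
  have "?G differentiable (at y)"
    using C y by (intro differentiable_sum differentiable_scaleR) auto
  then obtain G' where "(?G has_derivative G') (at y)" by (auto simp: differentiable_def)
  then have "(gradient h has_derivative G') (at y)"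
  proof (rule has_derivative_transform_within_open[OF _ A y])
    show "?G z = gradient h z" if "z \<in> A" for z
      using C that gradient_eqI[OF GDERIV_basis_sum, of h z] by simp
  qed
  then have "gradient h differentiable (at y)" by (auto simp: differentiable_def)
  then show ?thesis unfolding hessian_def by (simp add: jacobian_works)
qed

text \<open>The chain rule gives the derivative \<open>v \<mapsto> P v \<bullet> D\<close>; self-adjointness of the projection moves
  \<open>P\<close> onto \<open>D\<close>.\<close>

lemma gradient_proj_fun:
  fixes h :: "real^'n \<Rightarrow> real"
  assumes U: "subspace U" and D: "GDERIV h x0 :> D"
  shows "gradient (proj_fun U x0 h) x0 = orth_proj U D"
proof (rule gradient_eqI)
  have P: "bounded_linear (orth_proj U)"
    using linear_orth_proj[OF U] by (simp add: linear_conv_bounded_linear)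
  have "((\<lambda>y. x0 + orth_proj U (y - x0)) has_derivative orth_proj U) (at x0)"
    by (auto intro!: derivative_eq_intros bounded_linear.has_derivative[OF P])
  moreover have "(h has_derivative (\<lambda>v. v \<bullet> D)) (at (x0 + orth_proj U (x0 - x0)))"
    using D linear_0[OF linear_orth_proj[OF U]] by (simp add: gderiv_def)
  ultimately have "(proj_fun U x0 h has_derivative (\<lambda>v. orth_proj U v \<bullet> D)) (at x0)"
    unfolding proj_fun_def by (rule has_derivative_compose)
  then show "GDERIV (proj_fun U x0 h) x0 :> orth_proj U D"
    by (simp add: gderiv_def orth_proj_self_adjoint[OF U])
qed

lemma GDERIV_divide:
  assumes f: "GDERIV f x :> df" and g: "GDERIV g x :> dg" and "g x \<noteq> 0"
  shows "GDERIV (\<lambda>y. f y / g y) x :> ((g x *\<^sub>R df - f x *\<^sub>R dg) /\<^sub>R (g x)\<^sup>2)"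
  unfolding gderiv_def
  by (rule has_derivative_eq_rhs[OF has_derivative_divide'
        [OF f[unfolded gderiv_def] g[unfolded gderiv_def]]])
    (use assms in \<open>auto simp: fun_eq_iff inner_diff_right power2_eq_square field_simps\<close>)


section \<open>Error of the central differences\<close>

text \<open>One step of integration from \<open>0\<close>: \<open>\<plusminus>\<phi>\<close> grows no faster than the primitive of \<open>c t\<^sup>k\<close>.\<close>

lemma abs_le_power_of_deriv:
  fixes \<phi> :: "real \<Rightarrow> real"
  assumes der: "\<And>t. 0 \<le> t \<Longrightarrow> t \<le> 1 \<Longrightarrow> (\<phi> has_real_derivative \<phi>' t) (at t)"
    and bnd: "\<And>t. 0 \<le> t \<Longrightarrow> t \<le> 1 \<Longrightarrow> \<bar>\<phi>' t\<bar> \<le> c * t ^ k"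
    and 0: "\<phi> 0 = 0" and t: "0 \<le> t" "t \<le> 1"
  shows "\<bar>\<phi> t\<bar> \<le> c / Suc k * t ^ Suc k"
proof -
  let ?p = "\<lambda>t. c / Suc k * t ^ Suc k"
  have p: "(?p has_real_derivative c * s ^ k) (at s)" for s
    by (rule DERIV_cong[OF DERIV_cmult[OF DERIV_pow]]) simp
  have "?p 0 - \<phi> 0 \<le> ?p t - \<phi> t"
  proof (rule DERIV_nonneg_imp_nondecreasing[OF t(1)])
    fix s assume "0 \<le> s" "s \<le> t"
    then show "\<exists>y. ((\<lambda>t. ?p t - \<phi> t) has_real_derivative y) (at s) \<and> 0 \<le> y"
      using DERIV_diff[OF p der, of s] bnd[of s] t by (intro exI[of _ "c * s ^ k - \<phi>' s"]) auto
  qed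
  moreover have "?p 0 + \<phi> 0 \<le> ?p t + \<phi> t"
  proof (rule DERIV_nonneg_imp_nondecreasing[OF t(1)])
    fix s assume "0 \<le> s" "s \<le> t"
    then show "\<exists>y. ((\<lambda>t. ?p t + \<phi> t) has_real_derivative y) (at s) \<and> 0 \<le> y"
      using DERIV_add[OF p der, of s] bnd[of s] t by (intro exI[of _ "c * s ^ k + \<phi>' s"]) auto
  qed
  ultimately show ?thesis using 0 by (auto simp: abs_le_iff)
qed

lemma abs_quadratic_form_le_opnorm:
  fixes M :: "real^'n^'n"
  shows "\<bar>(M *v d) \<bullet> d\<bar> \<le> opnorm M * (norm d)\<^sup>2"
proof -
  have "\<bar>(M *v d) \<bullet> d\<bar> \<le> norm (M *v d) * norm d" by (rule Cauchy_Schwarz_ineq2)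
  also have "\<dots> \<le> (opnorm M * norm d) * norm d"
    unfolding opnorm_def by (intro mult_right_mono onorm) auto
  finally show ?thesis by (simp add: power2_eq_square mult.assoc)
qed

text \<open>Two integrations of the second derivative of
  \<open>t \<mapsto> h(x\<^sup>0 + t d) - h(x\<^sup>0 - t d) - 2 t d \<bullet> \<nabla>h(x\<^sup>0)\<close>.  That derivative compares the Hessian at
  two points at distance \<open>2 t \<parallel>d\<parallel>\<close>, so the Lipschitz condition makes it \<open>O(t)\<close>.\<close>

lemma central_difference_error:
  fixes h :: "real^'n \<Rightarrow> real"
  assumes C: "Ck_on (Suc (Suc k)) h (ball x0 r)"
    and L: "\<And>y z. y \<in> ball x0 r \<Longrightarrow> z \<in> ball x0 r \<Longrightarrow>
              opnorm (hessian h y - hessian h z) \<le> L * norm (y - z)"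
    and d: "norm d < r"
  shows "\<bar>(h (x0 + d) - h (x0 - d)) / 2 - d \<bullet> gradient h x0\<bar> \<le> L / 6 * norm d ^ 3"
proof -
  define \<phi> where "\<phi> t = h (x0 + t *\<^sub>R d) - h (x0 - t *\<^sub>R d) - 2 * t * (d \<bullet> gradient h x0)" for t
  define \<psi> where "\<psi> t = d \<bullet> gradient h (x0 + t *\<^sub>R d) + d \<bullet> gradient h (x0 - t *\<^sub>R d)
                     - 2 * (d \<bullet> gradient h x0)" for t
  define \<omega> where "\<omega> t = d \<bullet> (hessian h (x0 + t *\<^sub>R d) *v d)
                     - d \<bullet> (hessian h (x0 - t *\<^sub>R d) *v d)" for t
  define c where "c = 2 * L * norm d ^ 3"
  have in_ball: "x0 + t *\<^sub>R d \<in> ball x0 r" "x0 - t *\<^sub>R d \<in> ball x0 r" if "0 \<le> t" "t \<le> 1" for t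
  proof -
    have "t * norm d \<le> norm d" using that by (simp add: mult_left_le_one_le)
    then show "x0 + t *\<^sub>R d \<in> ball x0 r" "x0 - t *\<^sub>R d \<in> ball x0 r"
      using d that by (auto simp: dist_norm)
  qed
  have line: "((\<lambda>t. x0 + t *\<^sub>R d) has_derivative (\<lambda>s. s *\<^sub>R d)) (at t)"
       "((\<lambda>t. x0 - t *\<^sub>R d) has_derivative (\<lambda>s. - (s *\<^sub>R d))) (at t)" for t :: real
    by (auto intro!: derivative_eq_intros)
  have \<phi>': "(\<phi> has_real_derivative \<psi> t) (at t)" if t: "0 \<le> t" "t \<le> 1" for t
  proof -
    have "(h has_derivative (\<lambda>v. v \<bullet> gradient h y)) (at y)" if "y \<in> ball x0 r" for y
      using Ck_on_GDERIV[OF C that] by (simp add: gderiv_def)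
    note hd = has_derivative_compose[OF line(1) this[OF in_ball(1)[OF t]]]
      has_derivative_compose[OF line(2) this[OF in_ball(2)[OF t]]]
    show ?thesis
      unfolding \<phi>_def \<psi>_def has_field_derivative_def
      by (rule derivative_eq_intros hd refl)+ (auto simp: algebra_simps)
  qed
  have \<psi>': "(\<psi> has_real_derivative \<omega> t) (at t)" if t: "0 \<le> t" "t \<le> 1" for t
  proof -
    note gd = Ck_on_gradient_has_derivative[OF C open_ball]
    note hd = has_derivative_compose[OF line(1) gd[OF in_ball(1)[OF t]]]
      has_derivative_compose[OF line(2) gd[OF in_ball(2)[OF t]]]
    have neg: "M *v (- v) = - (M *v v)" for M :: "real^'n^'n" and v
      by (rule linear_neg[OF matrix_vector_mul_linear])
    show ?thesis
      unfolding \<psi>_def \<omega>_def has_field_derivative_def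
      by (rule derivative_eq_intros hd refl)+
        (auto simp: algebra_simps neg)
  qed
  have \<omega>: "\<bar>\<omega> t\<bar> \<le> c * t ^ 1" if t: "0 \<le> t" "t \<le> 1" for t
  proof -
    let ?M = "hessian h (x0 + t *\<^sub>R d) - hessian h (x0 - t *\<^sub>R d)"
    have "\<bar>\<omega> t\<bar> = \<bar>(?M *v d) \<bullet> d\<bar>"
      by (simp add: \<omega>_def matrix_vector_mult_diff_rdistrib inner_diff_right
          inner_commute[of _ d])
    also have "\<dots> \<le> opnorm ?M * (norm d)\<^sup>2" by (rule abs_quadratic_form_le_opnorm)
    also have "\<dots> \<le> (L * norm ((x0 + t *\<^sub>R d) - (x0 - t *\<^sub>R d))) * (norm d)\<^sup>2"
      by (intro mult_right_mono L in_ball t) auto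
    also have "(x0 + t *\<^sub>R d) - (x0 - t *\<^sub>R d) = (2 * t) *\<^sub>R d"
      by (simp add: algebra_simps flip: scaleR_2)
    finally show ?thesis
      using t by (simp add: c_def power2_eq_square power3_eq_cube mult_ac)
  qed
  have "\<bar>\<psi> t\<bar> \<le> c / 2 * t ^ 2" if t: "0 \<le> t" "t \<le> 1" for t
    using abs_le_power_of_deriv[of \<psi> \<omega> c 1 t, OF \<psi>' \<omega>] t
    by (simp add: \<psi>_def numeral_2_eq_2)
  then have "\<bar>\<phi> 1\<bar> \<le> c / 6"
    using abs_le_power_of_deriv[of \<phi> \<psi> "c / 2" 2 1, OF \<phi>'] by (simp add: \<phi>_def)
  then have "\<bar>\<phi> 1 / 2\<bar> \<le> L / 6 * norm d ^ 3"
    by (simp add: c_def)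
  moreover have "(h (x0 + d) - h (x0 - d)) / 2 - d \<bullet> gradient h x0 = \<phi> 1 / 2"
    by (simp add: \<phi>_def)
  ultimately show ?thesis by (simp only:)
qed

lemma norm_vec_le_sqrt_card:
  fixes v :: "real^'m"
  assumes "\<And>i. \<bar>v $ i\<bar> \<le> c"
  shows "norm v \<le> sqrt (real CARD('m)) * c"
proof -
  have "norm v \<le> L2_set (\<lambda>i. c) (UNIV :: 'm set)"
    unfolding norm_vec_def by (rule L2_set_mono) (use assms in auto)
  moreover have "0 \<le> c" using assms abs_ge_zero order_trans by blast
  ultimately show ?thesis by (simp add: L2_set_constant)
qed


section \<open>Error of the simplex gradients\<close>

text \<open>Since \<open>A\<^sup>\<dagger> A\<close> with \<open>A = S\<^sup>T\<close> is the projection, the difference on the left is \<open>A\<^sup>\<dagger>\<close> applied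
  to the vector of central difference errors.\<close>

lemma centred_simplex_gradient_error:
  fixes h :: "real^'n \<Rightarrow> real" and x :: "'m::finite \<Rightarrow> real^'n"
  assumes C: "Ck_on (Suc (Suc k)) h (ball x0 r)"
    and L: "\<And>y z. y \<in> ball x0 r \<Longrightarrow> z \<in> ball x0 r \<Longrightarrow>
              opnorm (hessian h y - hessian h z) \<le> L * norm (y - z)"
    and r: "radius x0 x < r" and pos: "0 < radius x0 x"
  defines "S \<equiv> simplex_matrix x0 x"
  shows "norm (centred_simplex_gradient h x0 x - orth_proj (span (columns S)) (gradient h x0))
         \<le> sqrt (real CARD('m)) / 6 * L * opnorm (pinv (transpose S)) * radius x0 x ^ 3"
proof -
  let ?\<Delta> = "radius x0 x"
  have le: "norm (x i - x0) \<le> ?\<Delta>" for i unfolding radius_def by (rule Max_ge) auto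
  have "?\<Delta> \<in> range (\<lambda>i. norm (x i - x0))" unfolding radius_def by (rule Max_in) auto
  then obtain j where j: "?\<Delta> = norm (x j - x0)" by auto
  have L0: "0 \<le> L"
  proof -
    \<comment> \<open>The Lipschitz condition between \<open>x\<^sup>0\<close> and a farthest point forces \<open>L \<ge> 0\<close>.\<close>
    have "0 \<le> opnorm (hessian h (x j) - hessian h x0)"
      unfolding opnorm_def by (rule onorm_pos_le) simp
    also have "\<dots> \<le> L * norm (x j - x0)"
    proof (rule L)
      show "x j \<in> ball x0 r" using r j by (simp add: dist_norm norm_minus_commute)
      show "x0 \<in> ball x0 r" using less_trans[OF pos r] by simp
    qed
    finally show ?thesis using pos j by (simp add: zero_le_mult_iff)
  qed
  define e where "e = centred_diff h x0 x - transpose S *v gradient h x0"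
  have "\<bar>e $ i\<bar> \<le> L / 6 * ?\<Delta> ^ 3" for i
  proof -
    have "e $ i = (h (x0 + (x i - x0)) - h (x0 - (x i - x0))) / 2 - (x i - x0) \<bullet> gradient h x0"
      by (simp add: e_def centred_diff_def S_def simplex_matrix_def vector_matrix_mult_def
          inner_vec_def mult.commute)
    then have "\<bar>e $ i\<bar> \<le> L / 6 * norm (x i - x0) ^ 3"
      using central_difference_error[OF C L, of "x i - x0"] le[of i] r by simp
    also have "\<dots> \<le> L / 6 * ?\<Delta> ^ 3"
      using L0 le by (intro mult_left_mono power_mono) auto
    finally show ?thesis .
  qed
  then have e: "norm e \<le> sqrt (real CARD('m)) * (L / 6 * ?\<Delta> ^ 3)"
    by (rule norm_vec_le_sqrt_card)
  have "centred_simplex_gradient h x0 x - orth_proj (span (columns S)) (gradient h x0)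
        = pinv (transpose S) *v e"
    unfolding e_def matrix_vector_mult_diff_distrib pinv_transpose_mult_eq_orth_proj
    by (simp add: centred_simplex_gradient_def S_def)
  also have "norm \<dots> \<le> opnorm (pinv (transpose S)) * norm e"
    unfolding opnorm_def by (rule onorm) simp
  also have "\<dots> \<le> opnorm (pinv (transpose S)) * (sqrt (real CARD('m)) * (L / 6 * ?\<Delta> ^ 3))"
    by (rule mult_left_mono[OF e]) (simp add: opnorm_def onorm_pos_le)
  finally show ?thesis by (simp add: mult_ac)
qed

lemma opnorm_pinv_normalised:
  fixes S :: "real^'m^'n"
  assumes "0 < c"
  shows "opnorm (pinv (transpose (S /\<^sub>R c))) = c * opnorm (pinv (transpose S))"
proof -
  have "pinv (transpose (S /\<^sub>R c)) = c *\<^sub>R pinv (transpose S)"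
    using assms pinv_scaleR[of "inverse c" "transpose S"] by (simp add: transpose_scalar)
  then show ?thesis
    using assms onorm_scaleR[of "(*v) (pinv (transpose S))" c]
    by (simp add: opnorm_def scaleR_matrix_vector_assoc)
qed

theorem proposition5p6:
  fixes f g :: "real^'n \<Rightarrow> real"
    and x0 :: "real^'n"
    and x :: "'m::finite \<Rightarrow> real^'n"
    and Lf Lg \<Delta> \<Delta>bar :: real
    and S Shat :: "real^'m^'n"
    and U :: "(real^'n) set"
  assumes "Ck_on 3 f (ball x0 \<Delta>bar)"
    and "Ck_on 3 g (ball x0 \<Delta>bar)"
    and "\<And>y z. y \<in> ball x0 \<Delta>bar \<Longrightarrow> z \<in> ball x0 \<Delta>bar \<Longrightarrow>
           opnorm (hessian f y - hessian f z) \<le> Lf * norm (y - z)"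
    and "\<And>y z. y \<in> ball x0 \<Delta>bar \<Longrightarrow> z \<in> ball x0 \<Delta>bar \<Longrightarrow>
           opnorm (hessian g y - hessian g z) \<le> Lg * norm (y - z)"
    and "distinct_points x0 x"
    and "\<Delta> = radius x0 x"
    and "\<Delta> < \<Delta>bar"
    and "S = simplex_matrix x0 x"
    and "rank S = min CARD('m) CARD('n)"
    and "U = span (columns S)"
    and "Shat = S /\<^sub>R \<Delta>"
    and "g x0 \<noteq> 0"
  shows "norm (centred_quotient_gradient f g x0 x
                 - gradient (proj_fun U x0 (\<lambda>y. f y / g y)) x0)
         \<le> sqrt (real CARD('m)) / 6
             * (Lf * \<bar>1 / g x0\<bar> + Lg * \<bar>f x0 / (g x0)\<^sup>2\<bar>)
             * opnorm (pinv (transpose Shat)) * \<Delta>\<^sup>2"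
proof -
  have C: "Ck_on (Suc (Suc 1)) f (ball x0 \<Delta>bar)" "Ck_on (Suc (Suc 1)) g (ball x0 \<Delta>bar)"
    using assms(1,2) by (simp_all only: numeral_3_eq_3 One_nat_def)
  have pos: "0 < \<Delta>"
  proof -
    fix i
    have "x i \<noteq> x0" using assms(5) by (metis distinct_points_def rangeI)
    then have "0 < norm (x i - x0)" by simp
    also have "\<dots> \<le> \<Delta>" unfolding assms(6) radius_def by (rule Max_ge) auto
    finally show ?thesis .
  qed
  have x0: "x0 \<in> ball x0 \<Delta>bar" using pos assms(7) by simp
  have U: "subspace U" unfolding assms(10) by (rule subspace_span)
  define P where "P = orth_proj U"
  define K where "K = sqrt (real CARD('m)) / 6 * opnorm (pinv (transpose S)) * \<Delta> ^ 3"
  define ef where "ef = centred_simplex_gradient f x0 x - P (gradient f x0)"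
  define eg where "eg = centred_simplex_gradient g x0 x - P (gradient g x0)"
  have ef: "norm ef \<le> Lf * K"
    using centred_simplex_gradient_error[OF C(1) assms(3), of x] pos assms(7)
    by (simp add: ef_def P_def K_def assms(6,8,10) mult_ac)
  have eg: "norm eg \<le> Lg * K"
    using centred_simplex_gradient_error[OF C(2) assms(4), of x] pos assms(7)
    by (simp add: eg_def P_def K_def assms(6,8,10) mult_ac)
  have "gradient (proj_fun U x0 (\<lambda>y. f y / g y)) x0
        = P ((g x0 *\<^sub>R gradient f x0 - f x0 *\<^sub>R gradient g x0) /\<^sub>R (g x0)\<^sup>2)"
    unfolding P_def
    by (intro gradient_proj_fun U GDERIV_divide Ck_on_GDERIV[OF C(1)] Ck_on_GDERIV[OF C(2)] x0 assms)
  also have "\<dots> = (g x0 *\<^sub>R P (gradient f x0) - f x0 *\<^sub>R P (gradient g x0)) /\<^sub>R (g x0)\<^sup>2"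
    using linear_orth_proj[OF U] by (simp add: P_def linear_diff linear_cmul)
  finally have "centred_quotient_gradient f g x0 x - gradient (proj_fun U x0 (\<lambda>y. f y / g y)) x0
        = (g x0 *\<^sub>R ef - f x0 *\<^sub>R eg) /\<^sub>R (g x0)\<^sup>2"
    by (simp add: centred_quotient_gradient_def ef_def eg_def algebra_simps)
  also have "\<dots> = (1 / g x0) *\<^sub>R ef - (f x0 / (g x0)\<^sup>2) *\<^sub>R eg"
    using assms(12) by (simp add: scaleR_diff_right power2_eq_square divide_inverse mult.commute)
  also have "norm \<dots> \<le> \<bar>1 / g x0\<bar> * norm ef + \<bar>f x0 / (g x0)\<^sup>2\<bar> * norm eg"
    by (rule order_trans[OF norm_triangle_ineq4]) simp
  also have "\<dots> \<le> \<bar>1 / g x0\<bar> * (Lf * K) + \<bar>f x0 / (g x0)\<^sup>2\<bar> * (Lg * K)"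
    by (intro add_mono mult_left_mono ef eg) auto
  also have "\<dots> = (Lf * \<bar>1 / g x0\<bar> + Lg * \<bar>f x0 / (g x0)\<^sup>2\<bar>) * K"
    by (simp only: ring_distribs mult_ac)
  also have "K = sqrt (real CARD('m)) / 6 * opnorm (pinv (transpose Shat)) * \<Delta>\<^sup>2"
    unfolding K_def assms(11) opnorm_pinv_normalised[OF pos]
    by (simp add: power2_eq_square power3_eq_cube)
  finally show ?thesis by (simp only: mult_ac)
qed

end
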